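(* Let $G$ be a finite group with unit element $e$, and let $S$ be a subset of $G$ such that $e \in S$ and $|S|$ divides $|G|$. Suppose there exist a group $H$, with unit element $e'$, and a bijective map $\varphi : H \rightarrow S$ such that $\varphi(e') = e$ and $$ \Theta_{G}(S ; [x_{s}]) = \hat{\varphi} \left( \Theta(H)^{\frac{|G|}{|H|}} \right). $$ Then $S$ (with the multiplication of $G$) is a group isomorphic to $H$, and $\varphi$ is either a group isomorphism or a group anti-isomorphism from $H$ to $S$.
   Context: For a finite group $G$ and a subset $S \subseteq G$, let $x_s$ ($s \in S$) be independent commuting variables, put $[x_s] = \{x_s \mid s \in S\}$, and set $x_g = 0$ for $g \in G \setminus S$. The generalized group determinant of $G$ to $S$ in $[x_s]$ is $$\Theta_G(S;[x_s]) := \det\left(x_{gh^{-1}}\right)_{g,h \in G} \in \mathbb{C}[x_s],$$ where $\mathbb{C}[x_s]$ is the polynomial ring over $\mathbb{C}$ in the variables $[x_s]$; it does not depend on the ordering of the elements of $G$. For a finite group $H$, $\Theta(H) := \Theta_H(H;[x_h]) = \det(x_{gh^{-1}})_{g,h\in H}$, a polynomial in the independent commuting variables $x_h$ ($h \in H$), is the (ordinary) group determinant of $H$. A bijection $\varphi : H \to S$ induces the $\mathbb{C}$-algebra isomorphism $\hat\varphi$ from the polynomial ring over $\mathbb{C}$ in the variables $x_h$ ($h\in H$) to the polynomial ring over $\mathbb{C}$ in the variables $x_s$ ($s \in S$), determined by $x_h \mapsto x_{\varphi(h)}$. Here $|A|$ denotes the cardinality of $A$. Since $\varphi$ is a bijection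 onto $S$, $H$ is finite with $|H| = |S|$, so $|G|/|H|$ is a positive integer. A group anti-isomorphism is a bijection $\varphi$ with $\varphi(hh') = \varphi(h')\varphi(h)$ for all $h,h'$. *)

theory Defs
  imports
    Complex_Main
    "HOL-Library.Poly_Mapping"
    "HOL-Combinatorics.Permutations"
    "HOL-Algebra.Coset"
begin

text \<open>
  Complex polynomials in commuting variables \<open>x\<^sub>a\<close> indexed by the elements of \<open>'a\<close>: finitely
  supported functions from monomials (finitely supported exponent vectors) to coefficients, with the
  convolution product of \<^theory>\<open>HOL-Library.Poly_Mapping\<close>. For \<open>S :: 'a set\<close>, the ring
  \<open>\<complex>[x\<^sub>s]\<close> (\<open>s \<in> S\<close>) is the subring of the polynomials whose monomials involve only
  variables indexed by \<open>S\<close>.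
\<close>

type_synonym 'a cpoly = "('a \<Rightarrow>\<^sub>0 nat) \<Rightarrow>\<^sub>0 complex"

definition Var :: "'a \<Rightarrow> 'a cpoly" where
  "Var a = Poly_Mapping.single (Poly_Mapping.single a 1) 1"

definition Const :: "complex \<Rightarrow> 'a cpoly" where
  "Const c = Poly_Mapping.single 0 c"

text \<open>
  The \<open>\<complex>\<close>-algebra homomorphism determined by \<open>x\<^sub>a \<mapsto> x\<^bsub>\<phi> a\<^esub>\<close>. It is total on
  \<open>'a cpoly\<close>; on polynomials in the variables \<open>x\<^sub>h\<close> (\<open>h \<in> H\<close>) it only depends on the
  values of \<open>\<phi>\<close> on \<open>H\<close>.
\<close>

definition poly_hat :: "('a \<Rightarrow> 'b) \<Rightarrow> 'a cpoly \<Rightarrow> 'b cpoly" where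
  "poly_hat \<phi> p =
     (\<Sum>m \<in> Poly_Mapping.keys p. Const (Poly_Mapping.lookup p m) *
        (\<Prod>a \<in> Poly_Mapping.keys m. Var (\<phi> a) ^ Poly_Mapping.lookup m a))"

text \<open>
  Determinant of a square matrix whose rows and columns are indexed by the same finite set, by the
  Leibniz formula; no ordering of the index set is involved.
\<close>

definition det_on :: "'i set \<Rightarrow> ('i \<Rightarrow> 'i \<Rightarrow> 'r::comm_ring_1) \<Rightarrow> 'r" where
  "det_on I M = (\<Sum>p | p permutes I. of_int (sign p) * (\<Prod>i\<in>I. M i (p i)))"

definition gen_group_det :: "('a, 'm) monoid_scheme \<Rightarrow> 'a set \<Rightarrow> 'a cpoly" where
  "gen_group_det G S =
     det_on (carrier G)
       (\<lambda>g h. if g \<otimes>\<^bsub>G\<^esub> inv\<^bsub>G\<^esub> h \<in> S then Var (g \<otimes>\<^bsub>G\<^esub> inv\<^bsub>G\<^esub> h) else 0)"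

definition group_det :: "('a, 'm) monoid_scheme \<Rightarrow> 'a cpoly" where
  "group_det H = gen_group_det H (carrier H)"

definition anti_iso :: "('a, 'm) monoid_scheme \<Rightarrow> ('b, 'n) monoid_scheme \<Rightarrow> ('a \<Rightarrow> 'b) set" where
  "anti_iso G H =
     {\<phi>. bij_betw \<phi> (carrier G) (carrier H) \<and>
         (\<forall>x\<in>carrier G. \<forall>y\<in>carrier G. \<phi> (x \<otimes>\<^bsub>G\<^esub> y) = \<phi> y \<otimes>\<^bsub>H\<^esub> \<phi> x)}"

end

theory Submission
  imports Defs "HOL-Computational_Algebra.Polynomial"
begin

text \<open>
  The proof uses only the part of the determinants that has degree at most three in the variables other
  than the variable of the unit. Specialize the variable of the unit to \<open>1\<close> and the variable of every other
  \<open>s \<in> S\<close> to \<open>t * d s\<close>. Then the determinant of \<open>G\<close> becomes \<open>det (1 + t X)\<close>, where the matrix \<open>X\<close> with entries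
  \<open>d (g h\<^bsup>-1\<^esup>)\<close> has zero diagonal. Hence its coefficients at \<open>t\<^sup>2\<close> and \<open>t\<^sup>3\<close> are
  \<open>- tr (X X) / 2\<close> and \<open>tr (X X X) / 3\<close> (lemma \<open>low_coeffs_det_pencil\<close>). For a group matrix these traces are
  \<open>order G\<close> times the sums of \<open>d a * d b\<close> over \<open>a b = 1\<close> and of \<open>d a * d b * d c\<close> over \<open>a b c = 1\<close>. The same
  holds for \<open>H\<close>, and since the coefficient at \<open>t\<close> vanishes, raising to the power \<open>order G / order H\<close> multiplies
  these two coefficients by that exponent, which makes up for the different group orders. So the two sums agree
  for \<open>G\<close> and \<open>H\<close> (lemma \<open>corr_eq\<close>).

  As \<open>d\<close> is arbitrary, polarization yields the counts for individual elements: \<open>x y = 1\<close> holds in \<open>H\<close>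
  if and only if \<open>\<phi> x \<phi> y = 1\<close>, and among the products \<open>x y\<close> and \<open>y x\<close> the element \<open>w\<close> occurs as often as \<open>\<phi> w\<close>
  occurs among \<open>\<phi> x \<phi> y\<close> and \<open>\<phi> y \<phi> x\<close> (lemma \<open>products_eq\<close>). In particular \<open>\<phi> (x y)\<close> is
  \<open>\<phi> x \<phi> y\<close> or \<open>\<phi> y \<phi> x\<close>. By Scott's theorem on half-homomorphisms (\<open>hom_or_antihom\<close>) the choice
  can be made once for all pairs. Therefore \<open>S\<close> is closed under products, and \<open>\<phi>\<close> is an isomorphism or an
  anti-isomorphism onto it; in the second case composition with inversion gives an isomorphism.
\<close>

(* Both the order of a group and the order of a root carry this name. *)
hide_const (open) Polynomial.order

section \<open>Half-homomorphisms of groups\<close>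

text \<open>
  Each \<open>x\<close> and \<open>y\<close> may choose independently whether their product is preserved or reversed. Scott's
  theorem, proved in this section, says that for injective maps between groups all these choices
  agree.
\<close>

locale half_homomorphism = A: group A + B: group B
  for A :: "('a, 'm) monoid_scheme" and B :: "('b, 'n) monoid_scheme" +
  fixes f :: "'a \<Rightarrow> 'b"
  assumes closed: "x \<in> carrier A \<Longrightarrow> f x \<in> carrier B"
    and inj: "inj_on f (carrier A)"
    and half: "x \<in> carrier A \<Longrightarrow> y \<in> carrier A \<Longrightarrow>
      f (x \<otimes>\<^bsub>A\<^esub> y) = f x \<otimes>\<^bsub>B\<^esub> f y \<or> f (x \<otimes>\<^bsub>A\<^esub> y) = f y \<otimes>\<^bsub>B\<^esub> f x"
begin

lemma commute_cancel:
  assumes "x \<in> carrier B" "y \<in> carrier B" "z \<in> carrier B"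
  shows "x \<otimes>\<^bsub>B\<^esub> (y \<otimes>\<^bsub>B\<^esub> z) = y \<otimes>\<^bsub>B\<^esub> (x \<otimes>\<^bsub>B\<^esub> z) \<longleftrightarrow> x \<otimes>\<^bsub>B\<^esub> y = y \<otimes>\<^bsub>B\<^esub> x"
  using assms by (metis B.m_assoc B.m_closed B.right_cancel)

text \<open>
  If the images \<open>p\<close> and \<open>q\<close> of a commuting pair did not commute, then with \<open>f (x y) = p q\<close> the two
  bracketings of \<open>x x y\<close> force \<open>f (x x y) = p p q\<close>, so that \<open>f (x x y y)\<close> is \<open>p p q q\<close> or \<open>q p p q\<close>; but
  \<open>x x y y = (x y) (x y)\<close> has image \<open>p q p q\<close>, which differs from both.
\<close>

lemma preserved_commuting_pair:
  assumes x: "x \<in> carrier A" and y: "y \<in> carrier A"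
    and comm: "x \<otimes>\<^bsub>A\<^esub> y = y \<otimes>\<^bsub>A\<^esub> x" and pres: "f (x \<otimes>\<^bsub>A\<^esub> y) = f x \<otimes>\<^bsub>B\<^esub> f y"
  shows "f x \<otimes>\<^bsub>B\<^esub> f y = f y \<otimes>\<^bsub>B\<^esub> f x"
proof (rule ccontr)
  define p q where "p = f x" and "q = f y"
  have pq: "p \<in> carrier B" "q \<in> carrier B"
    using x y closed by (auto simp: p_def q_def)
  assume "f x \<otimes>\<^bsub>B\<^esub> f y \<noteq> f y \<otimes>\<^bsub>B\<^esub> f x"
  then have ne: "p \<otimes>\<^bsub>B\<^esub> q \<noteq> q \<otimes>\<^bsub>B\<^esub> p" by (simp add: p_def q_def)
  have xy: "f (x \<otimes>\<^bsub>A\<^esub> y) = p \<otimes>\<^bsub>B\<^esub> q" using pres by (simp add: p_def q_def)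
  have xx: "f (x \<otimes>\<^bsub>A\<^esub> x) = p \<otimes>\<^bsub>B\<^esub> p" using half[OF x x] by (simp add: p_def)
  have "f (x \<otimes>\<^bsub>A\<^esub> (x \<otimes>\<^bsub>A\<^esub> y)) \<in> {p \<otimes>\<^bsub>B\<^esub> (p \<otimes>\<^bsub>B\<^esub> q), p \<otimes>\<^bsub>B\<^esub> (q \<otimes>\<^bsub>B\<^esub> p)}"
    using half[of x "x \<otimes>\<^bsub>A\<^esub> y"] x y pq by (auto simp: xy p_def[symmetric] B.m_assoc)
  moreover have "f (x \<otimes>\<^bsub>A\<^esub> (x \<otimes>\<^bsub>A\<^esub> y)) \<in> {p \<otimes>\<^bsub>B\<^esub> (p \<otimes>\<^bsub>B\<^esub> q), q \<otimes>\<^bsub>B\<^esub> (p \<otimes>\<^bsub>B\<^esub> p)}"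
    using half[of "x \<otimes>\<^bsub>A\<^esub> x" y] x y pq by (auto simp: xx q_def[symmetric] A.m_assoc B.m_assoc)
  ultimately have xxy: "f (x \<otimes>\<^bsub>A\<^esub> (x \<otimes>\<^bsub>A\<^esub> y)) = p \<otimes>\<^bsub>B\<^esub> (p \<otimes>\<^bsub>B\<^esub> q)"
    using ne pq by (auto simp: commute_cancel)
  have "f (x \<otimes>\<^bsub>A\<^esub> (x \<otimes>\<^bsub>A\<^esub> y) \<otimes>\<^bsub>A\<^esub> y) \<in>
      {p \<otimes>\<^bsub>B\<^esub> (p \<otimes>\<^bsub>B\<^esub> (q \<otimes>\<^bsub>B\<^esub> q)), q \<otimes>\<^bsub>B\<^esub> (p \<otimes>\<^bsub>B\<^esub> (p \<otimes>\<^bsub>B\<^esub> q))}"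
    using half[of "x \<otimes>\<^bsub>A\<^esub> (x \<otimes>\<^bsub>A\<^esub> y)" y] x y pq
    by (auto simp: xxy q_def[symmetric] B.m_assoc)
  moreover have "x \<otimes>\<^bsub>A\<^esub> (x \<otimes>\<^bsub>A\<^esub> y) \<otimes>\<^bsub>A\<^esub> y = (x \<otimes>\<^bsub>A\<^esub> y) \<otimes>\<^bsub>A\<^esub> (x \<otimes>\<^bsub>A\<^esub> y)"
    using x y comm by (metis A.m_assoc A.m_closed)
  moreover have "f ((x \<otimes>\<^bsub>A\<^esub> y) \<otimes>\<^bsub>A\<^esub> (x \<otimes>\<^bsub>A\<^esub> y)) = p \<otimes>\<^bsub>B\<^esub> (q \<otimes>\<^bsub>B\<^esub> (p \<otimes>\<^bsub>B\<^esub> q))"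
    using half[of "x \<otimes>\<^bsub>A\<^esub> y" "x \<otimes>\<^bsub>A\<^esub> y"] x y pq by (auto simp: xy B.m_assoc)
  ultimately show False
    using ne pq by (auto simp: commute_cancel)
qed

lemma commute_iff:
  assumes x: "x \<in> carrier A" and y: "y \<in> carrier A"
  shows "f x \<otimes>\<^bsub>B\<^esub> f y = f y \<otimes>\<^bsub>B\<^esub> f x \<longleftrightarrow> x \<otimes>\<^bsub>A\<^esub> y = y \<otimes>\<^bsub>A\<^esub> x"
proof
  assume "x \<otimes>\<^bsub>A\<^esub> y = y \<otimes>\<^bsub>A\<^esub> x"
  then show "f x \<otimes>\<^bsub>B\<^esub> f y = f y \<otimes>\<^bsub>B\<^esub> f x"
    using half[OF x y] preserved_commuting_pair[OF x y] preserved_commuting_pair[OF y x] by metis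
next
  assume "f x \<otimes>\<^bsub>B\<^esub> f y = f y \<otimes>\<^bsub>B\<^esub> f x"
  then have "f (x \<otimes>\<^bsub>A\<^esub> y) = f (y \<otimes>\<^bsub>A\<^esub> x)" using half[OF x y] half[OF y x] by auto
  then show "x \<otimes>\<^bsub>A\<^esub> y = y \<otimes>\<^bsub>A\<^esub> x" using inj x y by (auto dest: inj_onD)
qed

lemma swap_noncommuting:
  assumes x: "x \<in> carrier A" and y: "y \<in> carrier A" and ne: "x \<otimes>\<^bsub>A\<^esub> y \<noteq> y \<otimes>\<^bsub>A\<^esub> x"
  shows "f (y \<otimes>\<^bsub>A\<^esub> x) = f y \<otimes>\<^bsub>B\<^esub> f x \<longleftrightarrow> f (x \<otimes>\<^bsub>A\<^esub> y) = f x \<otimes>\<^bsub>B\<^esub> f y"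
    and "f (y \<otimes>\<^bsub>A\<^esub> x) = f x \<otimes>\<^bsub>B\<^esub> f y \<longleftrightarrow> f (x \<otimes>\<^bsub>A\<^esub> y) = f y \<otimes>\<^bsub>B\<^esub> f x"
proof -
  have "f (x \<otimes>\<^bsub>A\<^esub> y) \<noteq> f (y \<otimes>\<^bsub>A\<^esub> x)" using inj x y ne by (auto dest: inj_onD)
  then show "f (y \<otimes>\<^bsub>A\<^esub> x) = f y \<otimes>\<^bsub>B\<^esub> f x \<longleftrightarrow> f (x \<otimes>\<^bsub>A\<^esub> y) = f x \<otimes>\<^bsub>B\<^esub> f y"
    and "f (y \<otimes>\<^bsub>A\<^esub> x) = f x \<otimes>\<^bsub>B\<^esub> f y \<longleftrightarrow> f (x \<otimes>\<^bsub>A\<^esub> y) = f y \<otimes>\<^bsub>B\<^esub> f x"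
    using half[OF x y] half[OF y x] by auto
qed

text \<open>
  The local step: \<open>a\<close> cannot preserve one noncommuting product and reverse another. Write
  \<open>p\<close>, \<open>q\<close>, \<open>s\<close> for the images of \<open>a\<close>, \<open>b\<close>, \<open>c\<close>. Each bracketing of a word leaves two candidates for its
  image. For \<open>b a c\<close> the two bracketings have a common candidate only if \<open>q p s = s p q\<close>, which the word
  \<open>a b a c\<close> refutes, or if \<open>q\<close> and \<open>s\<close> commute and \<open>f (b a c) = q s p\<close>. In the latter case \<open>b\<close> and \<open>c\<close>
  commute, and the splittings \<open>(a b) c\<close>, \<open>(a c) b\<close> and \<open>a (b c)\<close> of the same element give \<open>f (a b c) = q s p\<close> too. Injectivity then makes
  \<open>a b\<close> equal to \<open>b a\<close>.
\<close>

lemma no_mixed_element: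
  assumes a: "a \<in> carrier A" and b: "b \<in> carrier A" and c: "c \<in> carrier A"
    and ab: "a \<otimes>\<^bsub>A\<^esub> b \<noteq> b \<otimes>\<^bsub>A\<^esub> a" and ac: "a \<otimes>\<^bsub>A\<^esub> c \<noteq> c \<otimes>\<^bsub>A\<^esub> a"
    and pres: "f (a \<otimes>\<^bsub>A\<^esub> b) = f a \<otimes>\<^bsub>B\<^esub> f b" and rev: "f (a \<otimes>\<^bsub>A\<^esub> c) = f c \<otimes>\<^bsub>B\<^esub> f a"
  shows False
proof -
  define p q s where "p = f a" and "q = f b" and "s = f c"
  note fold = p_def[symmetric] q_def[symmetric] s_def[symmetric]
  have car: "p \<in> carrier B" "q \<in> carrier B" "s \<in> carrier B"
    using a b c closed by (auto simp: p_def q_def s_def)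
  have pq: "p \<otimes>\<^bsub>B\<^esub> q \<noteq> q \<otimes>\<^bsub>B\<^esub> p" and ps: "p \<otimes>\<^bsub>B\<^esub> s \<noteq> s \<otimes>\<^bsub>B\<^esub> p"
    using commute_iff[OF a b] commute_iff[OF a c] ab ac by (auto simp: fold)
  note ne = pq ps pq[symmetric] ps[symmetric]
  have fab: "f (a \<otimes>\<^bsub>A\<^esub> b) = p \<otimes>\<^bsub>B\<^esub> q" and fba: "f (b \<otimes>\<^bsub>A\<^esub> a) = q \<otimes>\<^bsub>B\<^esub> p"
    using pres swap_noncommuting(1)[OF a b ab] by (auto simp: fold)
  have fac: "f (a \<otimes>\<^bsub>A\<^esub> c) = s \<otimes>\<^bsub>B\<^esub> p"
    using rev by (auto simp: fold)
  let ?bac = "b \<otimes>\<^bsub>A\<^esub> (a \<otimes>\<^bsub>A\<^esub> c)"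
  have "f ?bac \<in> {q \<otimes>\<^bsub>B\<^esub> (p \<otimes>\<^bsub>B\<^esub> s), s \<otimes>\<^bsub>B\<^esub> (q \<otimes>\<^bsub>B\<^esub> p)}"
    using half[of "b \<otimes>\<^bsub>A\<^esub> a" c] a b c car by (auto simp: fba fold A.m_assoc B.m_assoc)
  moreover have "f ?bac \<in> {q \<otimes>\<^bsub>B\<^esub> (s \<otimes>\<^bsub>B\<^esub> p), s \<otimes>\<^bsub>B\<^esub> (p \<otimes>\<^bsub>B\<^esub> q)}"
    using half[of b "a \<otimes>\<^bsub>A\<^esub> c"] a b c car by (auto simp: fac fold B.m_assoc)
  moreover have False
    if *: "f ?bac = q \<otimes>\<^bsub>B\<^esub> (p \<otimes>\<^bsub>B\<^esub> s)" "q \<otimes>\<^bsub>B\<^esub> (p \<otimes>\<^bsub>B\<^esub> s) = s \<otimes>\<^bsub>B\<^esub> (p \<otimes>\<^bsub>B\<^esub> q)"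
  proof -
    have "f (a \<otimes>\<^bsub>A\<^esub> ?bac) \<in> {p \<otimes>\<^bsub>B\<^esub> (q \<otimes>\<^bsub>B\<^esub> (s \<otimes>\<^bsub>B\<^esub> p)), s \<otimes>\<^bsub>B\<^esub> (p \<otimes>\<^bsub>B\<^esub> (p \<otimes>\<^bsub>B\<^esub> q))}"
      using half[of "a \<otimes>\<^bsub>A\<^esub> b" "a \<otimes>\<^bsub>A\<^esub> c"] a b c car by (auto simp: fab fac A.m_assoc B.m_assoc)
    moreover have "f (a \<otimes>\<^bsub>A\<^esub> ?bac) \<in> {p \<otimes>\<^bsub>B\<^esub> (q \<otimes>\<^bsub>B\<^esub> (p \<otimes>\<^bsub>B\<^esub> s)), q \<otimes>\<^bsub>B\<^esub> (p \<otimes>\<^bsub>B\<^esub> (s \<otimes>\<^bsub>B\<^esub> p))}"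
      using half[of a ?bac] a b c car by (auto simp: *(1) fold B.m_assoc)
    moreover have "q \<otimes>\<^bsub>B\<^esub> (p \<otimes>\<^bsub>B\<^esub> (s \<otimes>\<^bsub>B\<^esub> p)) = s \<otimes>\<^bsub>B\<^esub> (p \<otimes>\<^bsub>B\<^esub> (q \<otimes>\<^bsub>B\<^esub> p))"
      using *(2) car by (metis B.m_assoc B.m_closed)
    ultimately show False
      using ne car *(2) by (auto simp: commute_cancel)
  qed
  ultimately have bac: "f ?bac = q \<otimes>\<^bsub>B\<^esub> (s \<otimes>\<^bsub>B\<^esub> p)" and qs: "q \<otimes>\<^bsub>B\<^esub> s = s \<otimes>\<^bsub>B\<^esub> q"
    using ne car by (auto simp: commute_cancel)
  have bc: "b \<otimes>\<^bsub>A\<^esub> c = c \<otimes>\<^bsub>A\<^esub> b" using qs commute_iff[OF b c] by (simp add: fold)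
  let ?abc = "a \<otimes>\<^bsub>A\<^esub> (b \<otimes>\<^bsub>A\<^esub> c)"
  have fbc: "f (b \<otimes>\<^bsub>A\<^esub> c) = q \<otimes>\<^bsub>B\<^esub> s" using half[OF b c] qs by (auto simp: fold)
  have "f ?abc \<in> {p \<otimes>\<^bsub>B\<^esub> (q \<otimes>\<^bsub>B\<^esub> s), s \<otimes>\<^bsub>B\<^esub> (p \<otimes>\<^bsub>B\<^esub> q)}"
    using half[of "a \<otimes>\<^bsub>A\<^esub> b" c] a b c car by (auto simp: fab fold A.m_assoc B.m_assoc)
  moreover have "f ?abc \<in> {s \<otimes>\<^bsub>B\<^esub> (p \<otimes>\<^bsub>B\<^esub> q), q \<otimes>\<^bsub>B\<^esub> (s \<otimes>\<^bsub>B\<^esub> p)}"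
    using half[of "a \<otimes>\<^bsub>A\<^esub> c" b] a b c car by (auto simp: fac fold bc A.m_assoc B.m_assoc)
  moreover have "f ?abc \<in> {p \<otimes>\<^bsub>B\<^esub> (q \<otimes>\<^bsub>B\<^esub> s), q \<otimes>\<^bsub>B\<^esub> (s \<otimes>\<^bsub>B\<^esub> p)}"
    using half[of a "b \<otimes>\<^bsub>A\<^esub> c"] a b c car by (auto simp: fbc fold B.m_assoc)
  moreover have "p \<otimes>\<^bsub>B\<^esub> (q \<otimes>\<^bsub>B\<^esub> s) \<noteq> s \<otimes>\<^bsub>B\<^esub> (p \<otimes>\<^bsub>B\<^esub> q)"
    using ne car by (simp add: qs commute_cancel)
  moreover have "s \<otimes>\<^bsub>B\<^esub> (p \<otimes>\<^bsub>B\<^esub> q) \<noteq> q \<otimes>\<^bsub>B\<^esub> (s \<otimes>\<^bsub>B\<^esub> p)"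
  proof -
    have "q \<otimes>\<^bsub>B\<^esub> (s \<otimes>\<^bsub>B\<^esub> p) = s \<otimes>\<^bsub>B\<^esub> (q \<otimes>\<^bsub>B\<^esub> p)"
      using car qs by (metis B.m_assoc)
    then show ?thesis using ne car by simp
  qed
  ultimately have "f ?abc = f ?bac" using bac by auto
  then have "?abc = ?bac" using inj a b c by (auto dest: inj_onD)
  then have "a \<otimes>\<^bsub>A\<^esub> b = b \<otimes>\<^bsub>A\<^esub> a" using a b c by (metis A.m_assoc A.m_closed A.right_cancel)
  with ab show False ..
qed

text \<open>
  If \<open>a\<close>, \<open>b\<close> is a noncommuting preserved pair and \<open>c\<close>, \<open>d\<close> a noncommuting reversed one, then elements
  of different pairs commute, since otherwise their product would be preserved or reversed and one of
  the two would be mixed. Hence \<open>a c\<close> inherits a preserved noncommuting product with \<open>b\<close> from \<open>a\<close> and a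
  reversed one with \<open>d\<close> from \<open>c\<close>, so that \<open>a c\<close> is mixed.
\<close>

theorem hom_or_antihom:
  "(\<forall>x\<in>carrier A. \<forall>y\<in>carrier A. f (x \<otimes>\<^bsub>A\<^esub> y) = f x \<otimes>\<^bsub>B\<^esub> f y) \<or>
   (\<forall>x\<in>carrier A. \<forall>y\<in>carrier A. f (x \<otimes>\<^bsub>A\<^esub> y) = f y \<otimes>\<^bsub>B\<^esub> f x)"
proof (rule ccontr)
  assume "\<not> ?thesis"
  then obtain a b c d where car: "a \<in> carrier A" "b \<in> carrier A" "c \<in> carrier A" "d \<in> carrier A"
    and nab: "f (a \<otimes>\<^bsub>A\<^esub> b) \<noteq> f b \<otimes>\<^bsub>B\<^esub> f a" and ncd: "f (c \<otimes>\<^bsub>A\<^esub> d) \<noteq> f c \<otimes>\<^bsub>B\<^esub> f d"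
    by blast
  note closed' = car[THEN closed]
  have fab: "f (a \<otimes>\<^bsub>A\<^esub> b) = f a \<otimes>\<^bsub>B\<^esub> f b" and fcd: "f (c \<otimes>\<^bsub>A\<^esub> d) = f d \<otimes>\<^bsub>B\<^esub> f c"
    using half car nab ncd by blast+
  have ab: "a \<otimes>\<^bsub>A\<^esub> b \<noteq> b \<otimes>\<^bsub>A\<^esub> a" and cd: "c \<otimes>\<^bsub>A\<^esub> d \<noteq> d \<otimes>\<^bsub>A\<^esub> c"
    using nab ncd fab fcd commute_iff[OF car(1,2)] commute_iff[OF car(3,4)] by auto
  have cross: "x \<otimes>\<^bsub>A\<^esub> z = z \<otimes>\<^bsub>A\<^esub> x"
    if "x \<in> carrier A" "y \<in> carrier A" "z \<in> carrier A" "w \<in> carrier A"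
      "x \<otimes>\<^bsub>A\<^esub> y \<noteq> y \<otimes>\<^bsub>A\<^esub> x" "z \<otimes>\<^bsub>A\<^esub> w \<noteq> w \<otimes>\<^bsub>A\<^esub> z"
      "f (x \<otimes>\<^bsub>A\<^esub> y) = f x \<otimes>\<^bsub>B\<^esub> f y" "f (z \<otimes>\<^bsub>A\<^esub> w) = f w \<otimes>\<^bsub>B\<^esub> f z" for x y z w
  proof (rule ccontr)
    assume ne: "x \<otimes>\<^bsub>A\<^esub> z \<noteq> z \<otimes>\<^bsub>A\<^esub> x"
    show False
    proof (cases "f (x \<otimes>\<^bsub>A\<^esub> z) = f x \<otimes>\<^bsub>B\<^esub> f z")
      case True
      then have "f (z \<otimes>\<^bsub>A\<^esub> x) = f z \<otimes>\<^bsub>B\<^esub> f x"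
        using swap_noncommuting(1)[OF that(1,3) ne] by simp
      then show False
        using no_mixed_element[OF that(3,1,4) ne[symmetric] that(6)] that(8) by simp
    next
      case False
      then have "f (x \<otimes>\<^bsub>A\<^esub> z) = f z \<otimes>\<^bsub>B\<^esub> f x" using half[OF that(1,3)] by simp
      then show False
        using no_mixed_element[OF that(1,2,3,5) ne that(7)] by simp
    qed
  qed
  have fba: "f (b \<otimes>\<^bsub>A\<^esub> a) = f b \<otimes>\<^bsub>B\<^esub> f a" and fdc: "f (d \<otimes>\<^bsub>A\<^esub> c) = f c \<otimes>\<^bsub>B\<^esub> f d"
    using swap_noncommuting[OF car(1,2) ab] swap_noncommuting[OF car(3,4) cd] fab fcd by auto
  have comm: "a \<otimes>\<^bsub>A\<^esub> c = c \<otimes>\<^bsub>A\<^esub> a" "a \<otimes>\<^bsub>A\<^esub> d = d \<otimes>\<^bsub>A\<^esub> a" "b \<otimes>\<^bsub>A\<^esub> c = c \<otimes>\<^bsub>A\<^esub> b"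
    using cross[of a b c d] cross[of a b d c] cross[of b a c d] car ab cd fab fba fcd fdc
    by auto
  have comm': "f a \<otimes>\<^bsub>B\<^esub> f c = f c \<otimes>\<^bsub>B\<^esub> f a" "f a \<otimes>\<^bsub>B\<^esub> f d = f d \<otimes>\<^bsub>B\<^esub> f a"
      "f b \<otimes>\<^bsub>B\<^esub> f c = f c \<otimes>\<^bsub>B\<^esub> f b"
    using comm commute_iff car by auto
  let ?m = "a \<otimes>\<^bsub>A\<^esub> c"
  have fm: "f ?m = f a \<otimes>\<^bsub>B\<^esub> f c" using half[OF car(1,3)] comm' by auto
  have mc: "?m \<in> carrier A" using car by simp
  have mb: "?m \<otimes>\<^bsub>A\<^esub> b = (a \<otimes>\<^bsub>A\<^esub> b) \<otimes>\<^bsub>A\<^esub> c" "b \<otimes>\<^bsub>A\<^esub> ?m = (b \<otimes>\<^bsub>A\<^esub> a) \<otimes>\<^bsub>A\<^esub> c"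
    using car comm by (metis A.m_assoc)+
  have md: "?m \<otimes>\<^bsub>A\<^esub> d = a \<otimes>\<^bsub>A\<^esub> (c \<otimes>\<^bsub>A\<^esub> d)" "d \<otimes>\<^bsub>A\<^esub> ?m = a \<otimes>\<^bsub>A\<^esub> (d \<otimes>\<^bsub>A\<^esub> c)"
    using car comm by (metis A.m_assoc)+
  have "f (?m \<otimes>\<^bsub>A\<^esub> b) = f ?m \<otimes>\<^bsub>B\<^esub> f b"
  proof -
    have "f c \<otimes>\<^bsub>B\<^esub> (f a \<otimes>\<^bsub>B\<^esub> f b) = f a \<otimes>\<^bsub>B\<^esub> f b \<otimes>\<^bsub>B\<^esub> f c"
      using closed' comm' by (metis B.m_assoc)
    moreover have "f a \<otimes>\<^bsub>B\<^esub> f c \<otimes>\<^bsub>B\<^esub> f b = f a \<otimes>\<^bsub>B\<^esub> f b \<otimes>\<^bsub>B\<^esub> f c"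
      using closed' comm' by (metis B.m_assoc)
    ultimately show ?thesis
      using half[of "a \<otimes>\<^bsub>A\<^esub> b" c] car by (auto simp: mb fm fab)
  qed
  moreover have "f (?m \<otimes>\<^bsub>A\<^esub> d) = f d \<otimes>\<^bsub>B\<^esub> f ?m"
  proof -
    have "f d \<otimes>\<^bsub>B\<^esub> f c \<otimes>\<^bsub>B\<^esub> f a = f d \<otimes>\<^bsub>B\<^esub> (f a \<otimes>\<^bsub>B\<^esub> f c)"
      using closed' comm' by (metis B.m_assoc)
    moreover have "f a \<otimes>\<^bsub>B\<^esub> (f d \<otimes>\<^bsub>B\<^esub> f c) = f d \<otimes>\<^bsub>B\<^esub> (f a \<otimes>\<^bsub>B\<^esub> f c)"
      using closed' comm' by (metis B.m_assoc)
    ultimately show ?thesis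
      using half[of a "c \<otimes>\<^bsub>A\<^esub> d"] car by (auto simp: md fm fcd)
  qed
  moreover have "?m \<otimes>\<^bsub>A\<^esub> b \<noteq> b \<otimes>\<^bsub>A\<^esub> ?m" using ab car by (simp add: mb)
  moreover have "?m \<otimes>\<^bsub>A\<^esub> d \<noteq> d \<otimes>\<^bsub>A\<^esub> ?m" using cd car by (simp add: md)
  ultimately show False using no_mixed_element[OF mc car(2,4)] by blast
qed

end

section \<open>Evaluation of polynomials\<close>

text \<open>
  Values are taken in \<open>\<complex>[t]\<close>, so that a specialization of the variables can still record degrees.
\<close>

definition poly_eval :: "('a \<Rightarrow> complex poly) \<Rightarrow> 'a cpoly \<Rightarrow> complex poly" where
  "poly_eval f p = (\<Sum>m \<in> Poly_Mapping.keys p. smult (Poly_Mapping.lookup p m)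
     (\<Prod>a \<in> Poly_Mapping.keys m. f a ^ Poly_Mapping.lookup m a))"

lemma monomial_eval_add:
  fixes m n :: "'a \<Rightarrow>\<^sub>0 nat" and f :: "'a \<Rightarrow> 'r::comm_monoid_mult"
  shows "(\<Prod>a \<in> Poly_Mapping.keys (m + n). f a ^ Poly_Mapping.lookup (m + n) a) =
    (\<Prod>a \<in> Poly_Mapping.keys m. f a ^ Poly_Mapping.lookup m a) *
    (\<Prod>a \<in> Poly_Mapping.keys n. f a ^ Poly_Mapping.lookup n a)"
proof -
  let ?A = "Poly_Mapping.keys m \<union> Poly_Mapping.keys n"
  have ext: "(\<Prod>a \<in> Poly_Mapping.keys q. f a ^ Poly_Mapping.lookup q a) =
      (\<Prod>a \<in> ?A. f a ^ Poly_Mapping.lookup q a)" if "Poly_Mapping.keys q \<subseteq> ?A" for q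
    using that by (intro prod.mono_neutral_left) (auto simp: in_keys_iff)
  show ?thesis
    unfolding ext[OF keys_add] ext[OF Un_upper1] ext[OF Un_upper2]
    by (simp add: lookup_add power_add prod.distrib)
qed

lemma poly_eval_zero [simp]: "poly_eval f 0 = 0"
  by (simp add: poly_eval_def)

lemma poly_eval_single:
  "poly_eval f (Poly_Mapping.single m c) =
     smult c (\<Prod>a \<in> Poly_Mapping.keys m. f a ^ Poly_Mapping.lookup m a)"
  by (simp add: poly_eval_def)

lemma poly_eval_add: "poly_eval f (p + q) = poly_eval f p + poly_eval f q"
  unfolding poly_eval_def by (rule setsum_keys_plus_distrib) (simp_all add: smult_add_left)

lemma poly_mapping_add_induct:
  assumes "P 0" and "\<And>m c. P (Poly_Mapping.single m c)" and "\<And>p q. P p \<Longrightarrow> P q \<Longrightarrow> P (p + q)"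
  shows "P (p :: 'b \<Rightarrow>\<^sub>0 'c::comm_monoid_add)"
proof (induction p rule: update_induct)
  case const
  show ?case by (fact assms(1))
next
  case (update p m c)
  have "Poly_Mapping.update m c p = p + Poly_Mapping.single m c"
    using update(1)
    by (intro poly_mapping_eqI) (auto simp: lookup_update lookup_add lookup_single in_keys_iff when_def)
  then show ?case using assms(2,3) update by simp
qed

lemma poly_eval_mult: "poly_eval f (p * q) = poly_eval f p * poly_eval f q"
proof (induction p rule: poly_mapping_add_induct)
  case (2 m c)
  show ?case
    by (induction q rule: poly_mapping_add_induct)
      (simp_all add: mult_single poly_eval_single monomial_eval_add poly_eval_add distrib_left
        smult_add_right mult.commute[of _ c])
qed (simp_all add: poly_eval_add distrib_right)

lemma poly_eval_of_int: "poly_eval f (of_int k) = of_int k"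
  using poly_eval_single[of f 0 "of_int k"] by (simp add: of_int_poly)

lemma poly_eval_one: "poly_eval f 1 = 1"
  using poly_eval_of_int[of f 1] by simp

lemma poly_eval_sum: "poly_eval f (\<Sum>i\<in>I. p i) = (\<Sum>i\<in>I. poly_eval f (p i))"
  by (induction I rule: infinite_finite_induct) (simp_all add: poly_eval_add)

lemma poly_eval_prod: "poly_eval f (\<Prod>i\<in>I. p i) = (\<Prod>i\<in>I. poly_eval f (p i))"
  by (induction I rule: infinite_finite_induct) (simp_all add: poly_eval_mult poly_eval_one)

lemma poly_eval_power: "poly_eval f (p ^ k) = poly_eval f p ^ k"
  by (induction k) (simp_all add: poly_eval_mult poly_eval_one)

lemma poly_eval_Var: "poly_eval f (Var a) = f a"
  by (simp add: Var_def poly_eval_single)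

lemma poly_eval_Const: "poly_eval f (Const c) = [:c:]"
  by (simp add: Const_def poly_eval_single)

lemma poly_eval_det_on:
  "poly_eval f (det_on I M) = det_on I (\<lambda>i j. poly_eval f (M i j))"
  by (simp add: det_on_def poly_eval_sum poly_eval_mult poly_eval_prod poly_eval_of_int)

text \<open>
  Renaming variables is itself given by a sum over monomials, so evaluating a renamed polynomial needs
  only that evaluation respects sums and products.
\<close>

lemma poly_eval_poly_hat: "poly_eval f (poly_hat \<phi> p) = poly_eval (\<lambda>a. f (\<phi> a)) p"
  by (simp add: poly_hat_def poly_eval_def[of "\<lambda>a. f (\<phi> a)"] poly_eval_sum poly_eval_mult
      poly_eval_prod poly_eval_power poly_eval_Var poly_eval_Const)

section \<open>Low coefficients of a determinant\<close>

lemma det_on_cong: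
  assumes "\<And>i j. i \<in> I \<Longrightarrow> j \<in> I \<Longrightarrow> M i j = N i j"
  shows "det_on I M = det_on I N"
  unfolding det_on_def using assms by (intro sum.cong prod.cong arg_cong2[where f="(*)"] refl)
    (auto simp: permutes_in_image)

definition moved :: "('i \<Rightarrow> 'i) \<Rightarrow> 'i set \<Rightarrow> 'i set" where
  "moved p I = {i \<in> I. p i \<noteq> i}"

definition moving :: "'i set \<Rightarrow> nat \<Rightarrow> ('i \<Rightarrow> 'i) set" where
  "moving I n = {p. p permutes I \<and> card (moved p I) = n}"

text \<open>
  The contribution of \<open>p\<close> to \<open>det (1 + t X)\<close> for a matrix \<open>X\<close> with zero diagonal, without its power of \<open>t\<close>:
  each fixed point of \<open>p\<close> contributes a factor \<open>1\<close>, each moved point a factor \<open>t\<close>.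
\<close>

definition det_term :: "'i set \<Rightarrow> ('i \<Rightarrow> 'i \<Rightarrow> complex) \<Rightarrow> ('i \<Rightarrow> 'i) \<Rightarrow> complex" where
  "det_term I X p = of_int (sign p) * (\<Prod>i\<in>moved p I. X i (p i))"

text \<open>
  For \<open>X\<close> with zero diagonal this is \<open>1 + t X\<close>.
\<close>

definition pencil :: "('i \<Rightarrow> 'i \<Rightarrow> complex) \<Rightarrow> 'i \<Rightarrow> 'i \<Rightarrow> complex poly" where
  "pencil X i j = (if i = j then 1 else monom (X i j) 1)"

lemma prod_monom: "(\<Prod>i\<in>A. monom (c i) 1) = monom (\<Prod>i\<in>A. c i) (card A)"
  by (induction A rule: infinite_finite_induct) (simp_all add: mult_monom)

lemma coeff_det_pencil:
  assumes I: "finite I"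
  shows "coeff (det_on I (pencil X)) n = (\<Sum>p\<in>moving I n. det_term I X p)"
proof -
  have prod: "(\<Prod>i\<in>I. pencil X i (p i)) = monom (\<Prod>i\<in>moved p I. X i (p i)) (card (moved p I))" for p
  proof -
    have "(\<Prod>i\<in>I. pencil X i (p i)) = (\<Prod>i\<in>moved p I. monom (X i (p i)) 1)"
      using I by (intro prod.mono_neutral_cong_right) (auto simp: moved_def pencil_def)
    also have "\<dots> = monom (\<Prod>i\<in>moved p I. X i (p i)) (card (moved p I))"
      by (rule prod_monom)
    finally show ?thesis .
  qed
  have "coeff (det_on I (pencil X)) n =
      (\<Sum>p | p permutes I. if card (moved p I) = n then det_term I X p else 0)"
    unfolding det_on_def coeff_sum
    by (intro sum.cong refl) (auto simp: prod det_term_def of_int_poly)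
  also have "\<dots> = (\<Sum>p\<in>moving I n. det_term I X p)"
    using finite_permutations[OF I] by (simp add: moving_def sum.If_cases Collect_conj_eq)
  finally show ?thesis .
qed

text \<open>
  Counting pairs of a permutation and a point that it moves turns the sum over permutations into a
  sum over a base point. Once a base point is chosen, a permutation moving two or three points is
  determined by the orbit of that point.
\<close>

lemma moving_sum_pointed:
  assumes I: "finite I"
  shows "of_nat n * (\<Sum>p\<in>moving I n. det_term I X p) =
    (\<Sum>i\<in>I. \<Sum>p\<in>{p\<in>moving I n. p i \<noteq> i}. det_term I X p)"
proof -
  have fin: "finite (moving I n)"
    using finite_permutations[OF I] by (rule rev_finite_subset) (auto simp: moving_def)
  have "(\<Sum>i\<in>I. \<Sum>p\<in>{p\<in>moving I n. p i \<noteq> i}. det_term I X p) =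
      (\<Sum>p\<in>moving I n. \<Sum>i\<in>{i\<in>I. p i \<noteq> i}. det_term I X p)"
    by (rule sum.swap_restrict[OF I fin])
  also have "\<dots> = (\<Sum>p\<in>moving I n. of_nat n * det_term I X p)"
    by (intro sum.cong refl) (simp add: moving_def moved_def)
  finally show ?thesis by (simp add: sum_distrib_left)
qed

lemma moving_small:
  assumes I: "finite I"
  shows "moving I 0 = {id}" and "moving I 1 = {}"
proof -
  have fin: "finite (moved p I)" for p using I by (simp add: moved_def)
  have "p = id" if "p permutes I" "moved p I = {}" for p
    using that by (fastforce simp: moved_def permutes_def)
  moreover have "moved id I = {}" by (simp add: moved_def)
  ultimately show "moving I 0 = {id}" using fin by (auto simp: moving_def permutes_id)
  have "card (moved p I) \<noteq> 1" if p: "p permutes I" for p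
  proof
    assume "card (moved p I) = 1"
    then obtain i where i: "moved p I = {i}" by (auto simp: card_1_singleton_iff)
    then have "i \<in> I" "p i \<noteq> i" by (auto simp: moved_def)
    then have "p i \<in> moved p I"
      using p permutes_inj[OF p] by (auto simp: moved_def permutes_in_image dest: injD)
    with i \<open>p i \<noteq> i\<close> show False by simp
  qed
  then show "moving I 1 = {}" by (auto simp: moving_def)
qed

text \<open>
  By injectivity the image of a moved point is again moved, so the moved points absorb the whole orbit of
  any one of them; with only two or three moved points there is no room for anything but that orbit.
\<close>

lemma moving_two_is_transposition:
  assumes I: "finite I" and p: "p \<in> moving I 2" and i: "p i \<noteq> i"
  shows "p (p i) = i" and "moved p I = {i, p i}" and "p = transpose i (p i)"
proof -
  have perm: "p permutes I" and card: "card (moved p I) = 2" using p by (auto simp: moving_def)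
  have inj: "p x = p y \<longleftrightarrow> x = y" for x y using permutes_inj[OF perm] by (auto dest: injD)
  have fin: "finite (moved p I)" using I by (simp add: moved_def)
  have mem: "x \<in> moved p I \<longleftrightarrow> p x \<noteq> x" for x
    using perm by (auto simp: moved_def permutes_def)
  have "{i, p i} \<subseteq> moved p I" using i by (simp add: mem inj)
  then show eq: "moved p I = {i, p i}"
    using card_subset_eq[OF fin, of "{i, p i}"] card i by simp
  have "p (p i) \<in> {i, p i}" unfolding eq[symmetric] using i by (simp add: mem inj)
  then show "p (p i) = i" using i by (simp add: inj)
  then show "p = transpose i (p i)"
    using eq mem by (force simp: transpose_def)
qed

lemma moving_three_is_cycle:
  assumes I: "finite I" and p: "p \<in> moving I 3" and i: "p i \<noteq> i"
  shows "p (p i) \<noteq> i" and "p (p (p i)) = i" and "moved p I = {i, p i, p (p i)}"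
    and "p = transpose i (p i) \<circ> transpose (p i) (p (p i))"
proof -
  have perm: "p permutes I" and card: "card (moved p I) = 3" using p by (auto simp: moving_def)
  have inj: "p x = p y \<longleftrightarrow> x = y" for x y using permutes_inj[OF perm] by (auto dest: injD)
  have fin: "finite (moved p I)" using I by (simp add: moved_def)
  have mem: "x \<in> moved p I \<longleftrightarrow> p x \<noteq> x" for x
    using perm by (auto simp: moved_def permutes_def)
  show ne: "p (p i) \<noteq> i"
  proof
    \<comment> \<open>Otherwise the third moved point is sent to a moved point outside \<open>{i, p i}\<close>, hence to itself.\<close>
    assume *: "p (p i) = i"
    have sub: "{i, p i} \<subseteq> moved p I" using i by (simp add: mem inj)
    then have "card (moved p I - {i, p i}) = 1"
      using card i by (simp add: card_Diff_subset)
    then obtain z where z: "moved p I - {i, p i} = {z}" by (auto simp: card_1_singleton_iff)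
    then have "p z \<noteq> z" "z \<noteq> i" "z \<noteq> p i" using mem by blast+
    then have "p z \<in> moved p I - {i, p i}" using * by (metis Diff_iff inj insert_iff mem singletonD)
    with z \<open>p z \<noteq> z\<close> show False by auto
  qed
  have "{i, p i, p (p i)} \<subseteq> moved p I" using i by (simp add: mem inj)
  moreover have "card {i, p i, p (p i)} = 3" using i ne by (auto simp: inj)
  ultimately show eq: "moved p I = {i, p i, p (p i)}"
    using card_subset_eq[OF fin, of "{i, p i, p (p i)}"] card by simp
  have "p (p (p i)) \<in> {i, p i, p (p i)}" unfolding eq[symmetric] using i by (simp add: mem inj)
  then show *: "p (p (p i)) = i" using i ne by (simp add: inj)
  show "p = transpose i (p i) \<circ> transpose (p i) (p (p i))"
  proof
    fix x
    show "p x = (transpose i (p i) \<circ> transpose (p i) (p (p i))) x"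
    proof (cases "x \<in> {i, p i, p (p i)}")
      case True
      then show ?thesis using i ne * by (auto simp: transpose_def inj)
    next
      case False
      then have "p x = x" using eq mem by auto
      then show ?thesis using False by (auto simp: transpose_def)
    qed
  qed
qed

lemma pointed_sum_2:
  assumes I: "finite I" and diag: "\<And>i. i \<in> I \<Longrightarrow> X i i = 0" and i: "i \<in> I"
  shows "(\<Sum>p\<in>{p\<in>moving I 2. p i \<noteq> i}. det_term I X p) = - (\<Sum>j\<in>I. X i j * X j i)"
proof -
  have "(\<Sum>p\<in>{p\<in>moving I 2. p i \<noteq> i}. det_term I X p) = (\<Sum>j\<in>I - {i}. - (X i j * X j i))"
  proof (rule sum.reindex_bij_witness[where i = "\<lambda>j. transpose i j" and j = "\<lambda>p. p i"])
    fix j assume j: "j \<in> I - {i}"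
    then have "moved (transpose i j) I = {i, j}" using i by (auto simp: moved_def transpose_def)
    then show "transpose i j \<in> {p \<in> moving I 2. p i \<noteq> i}"
      using i j by (auto simp: moving_def permutes_swap_id)
  next
    fix p assume "p \<in> {p \<in> moving I 2. p i \<noteq> i}"
    then have p: "p \<in> moving I 2" and ne: "p i \<noteq> i" by auto
    note m = moving_two_is_transposition[OF I p ne]
    show "p i \<in> I - {i}" using p ne i by (auto simp: moving_def permutes_in_image)
    show "transpose i (p i) = p" by (rule m(3)[symmetric])
    have "sign p = -1" using m(3) ne by (metis sign_swap_id)
    then show "- (X i (p i) * X (p i) i) = det_term I X p"
      using m(1,2) ne by (simp add: det_term_def)
  qed auto
  also have "\<dots> = (\<Sum>j\<in>I. - (X i j * X j i))"
    using I diag by (intro sum.mono_neutral_left) auto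
  finally show ?thesis by (simp add: sum_negf)
qed

lemma pointed_sum_3:
  assumes I: "finite I" and diag: "\<And>i. i \<in> I \<Longrightarrow> X i i = 0" and i: "i \<in> I"
  shows "(\<Sum>p\<in>{p\<in>moving I 3. p i \<noteq> i}. det_term I X p) =
    (\<Sum>j\<in>I. \<Sum>k\<in>I. X i j * X j k * X k i)"
proof -
  let ?D = "{(j, k). j \<in> I \<and> k \<in> I \<and> j \<noteq> i \<and> k \<noteq> i \<and> j \<noteq> k}"
  have "(\<Sum>p\<in>{p\<in>moving I 3. p i \<noteq> i}. det_term I X p) =
      (\<Sum>(j, k)\<in>?D. X i j * X j k * X k i)"
  proof (rule sum.reindex_bij_witness[where i = "\<lambda>(j, k). transpose i j \<circ> transpose j k"
        and j = "\<lambda>p. (p i, p (p i))"])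
    fix x assume "x \<in> ?D"
    then obtain j k where x: "x = (j, k)" "j \<in> I" "k \<in> I" "j \<noteq> i" "k \<noteq> i" "j \<noteq> k" by auto
    let ?p = "transpose i j \<circ> transpose j k"
    have "moved ?p I = {i, j, k}" using i x by (auto simp: moved_def transpose_def)
    moreover have "?p permutes I" using i x by (intro permutes_compose permutes_swap_id)
    moreover have "?p i = j" "?p j = k" using x by (auto simp: transpose_def)
    ultimately show "(case x of (j, k) \<Rightarrow> transpose i j \<circ> transpose j k) \<in> {p \<in> moving I 3. p i \<noteq> i}"
      and "((case x of (j, k) \<Rightarrow> transpose i j \<circ> transpose j k) i,
         (case x of (j, k) \<Rightarrow> transpose i j \<circ> transpose j k)
          ((case x of (j, k) \<Rightarrow> transpose i j \<circ> transpose j k) i)) = x"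
      using i x by (auto simp: moving_def)
  next
    fix p assume "p \<in> {p \<in> moving I 3. p i \<noteq> i}"
    then have p: "p \<in> moving I 3" and ne: "p i \<noteq> i" by auto
    note m = moving_three_is_cycle[OF I p ne]
    have perm: "p permutes I" using p by (simp add: moving_def)
    have ne': "p (p i) \<noteq> p i" using ne permutes_inj[OF perm] by (auto dest: injD)
    show "(p i, p (p i)) \<in> ?D"
      using i perm ne ne' m(1) by (auto simp: permutes_in_image)
    show "(case (p i, p (p i)) of (j, k) \<Rightarrow> transpose i j \<circ> transpose j k) = p"
      by (simp add: m(4)[symmetric])
    have "sign (transpose i (p i) \<circ> transpose (p i) (p (p i))) = 1"
      using ne ne' by (subst sign_compose) (auto simp: permutation_swap_id sign_swap_id)
    then have "sign p = 1" by (simp only: m(4)[symmetric])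
    then show "(case (p i, p (p i)) of (j, k) \<Rightarrow> X i j * X j k * X k i) = det_term I X p"
      using m(1,2,3) ne ne' by (auto simp: det_term_def)
  qed
  also have "\<dots> = (\<Sum>(j, k)\<in>I \<times> I. X i j * X j k * X k i)"
    using I diag by (intro sum.mono_neutral_left) auto
  finally show ?thesis by (simp add: sum.cartesian_product)
qed

text \<open>
  Newton's identities in degrees two and three, for \<open>tr X = 0\<close>. A transposition has sign \<open>-1\<close> and two
  base points, a cycle of length three has sign \<open>1\<close> and three base points; the zero diagonal lets the sums
  over distinct indices run over all indices.
\<close>

lemma low_coeffs_det_pencil:
  assumes I: "finite I" and diag: "\<And>i. i \<in> I \<Longrightarrow> X i i = 0"
  shows "coeff (det_on I (pencil X)) 0 = 1"
    and "coeff (det_on I (pencil X)) 1 = 0"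
    and "2 * coeff (det_on I (pencil X)) 2 = - (\<Sum>i\<in>I. \<Sum>j\<in>I. X i j * X j i)"
    and "3 * coeff (det_on I (pencil X)) 3 = (\<Sum>i\<in>I. \<Sum>j\<in>I. \<Sum>k\<in>I. X i j * X j k * X k i)"
proof -
  show "coeff (det_on I (pencil X)) 0 = 1"
    unfolding coeff_det_pencil[OF I] moving_small[OF I] by (simp add: det_term_def moved_def)
  show "coeff (det_on I (pencil X)) 1 = 0"
    unfolding coeff_det_pencil[OF I] moving_small[OF I] by simp
  show "2 * coeff (det_on I (pencil X)) 2 = - (\<Sum>i\<in>I. \<Sum>j\<in>I. X i j * X j i)"
    using moving_sum_pointed[OF I, of 2 X] pointed_sum_2[where X = X, OF I diag]
    by (simp add: coeff_det_pencil[OF I] sum_negf)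
  show "3 * coeff (det_on I (pencil X)) 3 = (\<Sum>i\<in>I. \<Sum>j\<in>I. \<Sum>k\<in>I. X i j * X j k * X k i)"
    using moving_sum_pointed[OF I, of 3 X] pointed_sum_3[where X = X, OF I diag]
    by (simp add: coeff_det_pencil[OF I])
qed

text \<open>
  Modulo \<open>t ^ 4\<close> the powers of \<open>1 + a t\<^sup>2 + b t\<^sup>3\<close> are \<open>1 + r a t\<^sup>2 + r b t\<^sup>3\<close>: the first mixed term has
  degree \<open>4\<close>.
\<close>

lemma low_coeffs_power:
  fixes P :: "'r::comm_ring_1 poly"
  assumes "coeff P 0 = 1" and "coeff P 1 = 0"
  shows "coeff (P ^ r) 2 = of_nat r * coeff P 2" and "coeff (P ^ r) 3 = of_nat r * coeff P 3"
proof -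
  have "coeff (P ^ r) 0 = 1 \<and> coeff (P ^ r) 1 = 0 \<and>
    coeff (P ^ r) 2 = of_nat r * coeff P 2 \<and> coeff (P ^ r) 3 = of_nat r * coeff P 3"
  proof (induction r)
    case (Suc r)
    then show ?case
      using assms by (simp add: coeff_mult numeral_2_eq_2 numeral_3_eq_3 algebra_simps)
  qed simp
  then show "coeff (P ^ r) 2 = of_nat r * coeff P 2" and "coeff (P ^ r) 3 = of_nat r * coeff P 3"
    by auto
qed

section \<open>Specialized group determinants\<close>

text \<open>
  The sum of \<open>u a * v b\<close> over all pairs with \<open>a b = 1\<close>, and of \<open>u a * v b * w c\<close> over all triples with
  \<open>a b c = 1\<close>. They are kept linear in each argument so that they can be polarized.
\<close>

definition pair_corr :: "('a, 'm) monoid_scheme \<Rightarrow> ('a \<Rightarrow> complex) \<Rightarrow> ('a \<Rightarrow> complex) \<Rightarrow> complex" where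
  "pair_corr G u v = (\<Sum>a\<in>carrier G. u a * v (inv\<^bsub>G\<^esub> a))"

definition triple_corr ::
  "('a, 'm) monoid_scheme \<Rightarrow> ('a \<Rightarrow> complex) \<Rightarrow> ('a \<Rightarrow> complex) \<Rightarrow> ('a \<Rightarrow> complex) \<Rightarrow> complex" where
  "triple_corr G u v w =
     (\<Sum>a\<in>carrier G. \<Sum>b\<in>carrier G. u a * v b * w (inv\<^bsub>G\<^esub> (a \<otimes>\<^bsub>G\<^esub> b)))"

text \<open>
  The group determinant at \<open>x\<^sub>1 = 1\<close> and \<open>x\<^sub>g = t * d g\<close> for \<open>g \<noteq> 1\<close>.
\<close>

definition group_pencil :: "('a, 'm) monoid_scheme \<Rightarrow> ('a \<Rightarrow> complex) \<Rightarrow> complex poly" where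
  "group_pencil G d = det_on (carrier G) (pencil (\<lambda>g h. d (g \<otimes>\<^bsub>G\<^esub> inv\<^bsub>G\<^esub> h)))"

definition point_mass :: "'a \<Rightarrow> 'a \<Rightarrow> complex" where
  "point_mass s a = of_bool (a = s)"

context group
begin

lemma mult_inv_eq_one_iff:
  assumes "g \<in> carrier G" and "h \<in> carrier G"
  shows "g \<otimes> inv h = \<one> \<longleftrightarrow> g = h"
  using assms by (metis inv_closed inv_equality inv_inv r_inv)

text \<open>
  Entries of a group matrix depend only on the quotient \<open>g h\<^bsup>-1\<^esup>\<close>, so traces become sums over quotients.
  Each base point \<open>g\<close> then contributes the same amount, which is where the factor \<open>order G\<close> below comes
  from.
\<close>

lemma sum_over_quotients:
  assumes g: "g \<in> carrier G"
  shows "(\<Sum>h\<in>carrier G. F (g \<otimes> inv h) h) = (\<Sum>a\<in>carrier G. F a (inv a \<otimes> g))"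
  by (rule sum.reindex_bij_witness[where i = "\<lambda>a. inv a \<otimes> g" and j = "\<lambda>h. g \<otimes> inv h"])
    (use g in \<open>auto simp: inv_mult_group m_assoc[symmetric] r_inv\<close>, auto simp: m_assoc l_inv)

lemma pair_trace:
  "(\<Sum>g\<in>carrier G. \<Sum>h\<in>carrier G. d (g \<otimes> inv h) * d (h \<otimes> inv g)) = of_nat (order G) * pair_corr G d d"
proof -
  have "(\<Sum>h\<in>carrier G. d (g \<otimes> inv h) * d (h \<otimes> inv g)) = pair_corr G d d" if g: "g \<in> carrier G" for g
  proof -
    have "(\<Sum>h\<in>carrier G. d (g \<otimes> inv h) * d (h \<otimes> inv g)) =
        (\<Sum>a\<in>carrier G. d a * d (inv a \<otimes> g \<otimes> inv g))"
      by (rule sum_over_quotients[OF g])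
    also have "\<dots> = pair_corr G d d"
      unfolding pair_corr_def using g by (intro sum.cong) (auto simp: m_assoc)
    finally show ?thesis .
  qed
  then show ?thesis by (simp add: Coset.order_def)
qed

lemma triple_trace:
  "(\<Sum>g\<in>carrier G. \<Sum>h\<in>carrier G. \<Sum>k\<in>carrier G. d (g \<otimes> inv h) * d (h \<otimes> inv k) * d (k \<otimes> inv g)) =
    of_nat (order G) * triple_corr G d d d"
proof -
  have "(\<Sum>h\<in>carrier G. \<Sum>k\<in>carrier G. d (g \<otimes> inv h) * d (h \<otimes> inv k) * d (k \<otimes> inv g)) =
      triple_corr G d d d" if g: "g \<in> carrier G" for g
  proof -
    have "(\<Sum>h\<in>carrier G. \<Sum>k\<in>carrier G. d (g \<otimes> inv h) * d (h \<otimes> inv k) * d (k \<otimes> inv g)) =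
        (\<Sum>h\<in>carrier G. \<Sum>b\<in>carrier G. d (g \<otimes> inv h) * d b * d (inv b \<otimes> h \<otimes> inv g))"
    proof (rule sum.cong[OF refl])
      fix h assume "h \<in> carrier G"
      then show "(\<Sum>k\<in>carrier G. d (g \<otimes> inv h) * d (h \<otimes> inv k) * d (k \<otimes> inv g)) =
          (\<Sum>b\<in>carrier G. d (g \<otimes> inv h) * d b * d (inv b \<otimes> h \<otimes> inv g))"
        by (rule sum_over_quotients)
    qed
    also have "\<dots> = (\<Sum>a\<in>carrier G. \<Sum>b\<in>carrier G. d a * d b * d (inv b \<otimes> (inv a \<otimes> g) \<otimes> inv g))"
      by (rule sum_over_quotients[OF g])
    also have "\<dots> = triple_corr G d d d"
      unfolding triple_corr_def using g
      by (intro sum.cong refl) (auto simp: m_assoc inv_mult_group)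
    finally show ?thesis .
  qed
  then show ?thesis by (simp add: Coset.order_def)
qed

lemma low_coeffs_group_pencil:
  assumes fin: "finite (carrier G)" and d: "d \<one> = 0"
  shows "coeff (group_pencil G d) 0 = 1"
    and "coeff (group_pencil G d) 1 = 0"
    and "2 * coeff (group_pencil G d) 2 = - (of_nat (order G) * pair_corr G d d)"
    and "3 * coeff (group_pencil G d) 3 = of_nat (order G) * triple_corr G d d d"
proof -
  let ?X = "\<lambda>g h. d (g \<otimes> inv h)"
  have diag: "?X g g = 0" if "g \<in> carrier G" for g using that d by simp
  note c = low_coeffs_det_pencil[where X = ?X, OF fin diag, folded group_pencil_def]
  show "coeff (group_pencil G d) 0 = 1" by (rule c(1))
  show "coeff (group_pencil G d) 1 = 0" by (rule c(2))
  show "2 * coeff (group_pencil G d) 2 = - (of_nat (order G) * pair_corr G d d)"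
    using c(3) by (simp only: pair_trace)
  show "3 * coeff (group_pencil G d) 3 = of_nat (order G) * triple_corr G d d d"
    using c(4) by (simp only: triple_trace)
qed

lemma poly_eval_gen_group_det:
  assumes S: "\<one> \<in> S" and d: "\<And>g. g \<in> carrier G \<Longrightarrow> g \<notin> S \<Longrightarrow> d g = 0"
  shows "poly_eval (\<lambda>g. if g = \<one> then 1 else monom (d g) 1) (gen_group_det G S) = group_pencil G d"
  unfolding gen_group_det_def poly_eval_det_on group_pencil_def
  by (rule det_on_cong) (use S d in \<open>auto simp: poly_eval_Var pencil_def mult_inv_eq_one_iff\<close>)

lemma pair_corr_indicator:
  assumes fin: "finite (carrier G)" and x: "x \<in> carrier G" and y: "y \<in> carrier G"
  shows "pair_corr G (point_mass x) (point_mass y) = of_bool (x \<otimes> y = \<one>)"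
proof -
  have "pair_corr G (point_mass x) (point_mass y) =
      (\<Sum>a\<in>carrier G. if a = x then of_bool (inv x = y) else 0)"
    unfolding pair_corr_def point_mass_def by (intro sum.cong) auto
  also have "\<dots> = of_bool (inv x = y)" using fin x by simp
  also have "inv x = y \<longleftrightarrow> x \<otimes> y = \<one>" using x y by (metis inv_equality inv_inv inv_closed r_inv)
  finally show ?thesis .
qed

lemma triple_corr_indicator:
  assumes fin: "finite (carrier G)" and x: "x \<in> carrier G" and y: "y \<in> carrier G" and z: "z \<in> carrier G"
  shows "triple_corr G (point_mass x) (point_mass y) (point_mass z) =
    of_bool (x \<otimes> y \<otimes> z = \<one>)"
proof -
  have "triple_corr G (point_mass x) (point_mass y) (point_mass z) =
      (\<Sum>a\<in>carrier G. if a = x then \<Sum>b\<in>carrier G. if b = y then of_bool (inv (x \<otimes> y) = z) else 0 else 0)"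
    unfolding triple_corr_def point_mass_def by (intro sum.cong) (auto intro!: sum.cong sum.neutral)
  also have "\<dots> = of_bool (inv (x \<otimes> y) = z)" using fin x y by simp
  also have "inv (x \<otimes> y) = z \<longleftrightarrow> x \<otimes> y \<otimes> z = \<one>"
    using x y z by (metis inv_equality inv_inv inv_closed r_inv m_closed)
  finally show ?thesis .
qed

end

text \<open>
  Only the diagonal values of the correlation sums can be read off the determinants. Polarization
  recovers from them the values at three independent arguments, up to the order of the arguments.
\<close>

lemma pair_corr_polarization:
  "pair_corr G (\<lambda>a. u a + v a) (\<lambda>a. u a + v a) - pair_corr G u u - pair_corr G v v =
    pair_corr G u v + pair_corr G v u"
  by (simp add: pair_corr_def sum.distrib algebra_simps)

lemma triple_corr_polarization:
  "triple_corr G (\<lambda>a. u a + v a + w a) (\<lambda>a. u a + v a + w a) (\<lambda>a. u a + v a + w a)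
     - triple_corr G (\<lambda>a. u a + v a) (\<lambda>a. u a + v a) (\<lambda>a. u a + v a)
     - triple_corr G (\<lambda>a. u a + w a) (\<lambda>a. u a + w a) (\<lambda>a. u a + w a)
     - triple_corr G (\<lambda>a. v a + w a) (\<lambda>a. v a + w a) (\<lambda>a. v a + w a)
     + triple_corr G u u u + triple_corr G v v v + triple_corr G w w w =
   triple_corr G u v w + triple_corr G u w v + triple_corr G v u w +
   triple_corr G v w u + triple_corr G w u v + triple_corr G w v u"
  by (simp add: triple_corr_def sum.distrib algebra_simps)

lemma pair_corr_cong:
  assumes "group G" and "\<And>a. a \<in> carrier G \<Longrightarrow> u a = u' a" and "\<And>a. a \<in> carrier G \<Longrightarrow> v a = v' a"
  shows "pair_corr G u v = pair_corr G u' v'"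
  unfolding pair_corr_def using assms group.inv_closed[OF assms(1)] by (intro sum.cong) auto

lemma triple_corr_cong:
  assumes "group G" and "\<And>a. a \<in> carrier G \<Longrightarrow> u a = u' a" and "\<And>a. a \<in> carrier G \<Longrightarrow> v a = v' a"
    and "\<And>a. a \<in> carrier G \<Longrightarrow> w a = w' a"
  shows "triple_corr G u v w = triple_corr G u' v' w'"
proof -
  interpret group G by fact
  show ?thesis unfolding triple_corr_def using assms by (intro sum.cong refl) auto
qed

section \<open>From the determinant identity to products\<close>

locale determinant_factorization = G: group G + H: group H
  for G :: "('a, 'm) monoid_scheme" and H :: "('b, 'n) monoid_scheme" +
  fixes S :: "'a set" and \<phi> :: "'b \<Rightarrow> 'a"
  assumes finite_G: "finite (carrier G)"
    and subset: "S \<subseteq> carrier G"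
    and one_mem: "\<one>\<^bsub>G\<^esub> \<in> S"
    and card_dvd: "card S dvd order G"
    and bij: "bij_betw \<phi> (carrier H) S"
    and \<phi>_one: "\<phi> \<one>\<^bsub>H\<^esub> = \<one>\<^bsub>G\<^esub>"
    and det_eq: "gen_group_det G S = poly_hat \<phi> (group_det H ^ (order G div order H))"
begin

lemma \<phi>_mem: "x \<in> carrier H \<Longrightarrow> \<phi> x \<in> S"
  using bij by (auto simp: bij_betw_def)

lemma \<phi>_closed: "x \<in> carrier H \<Longrightarrow> \<phi> x \<in> carrier G"
  using \<phi>_mem subset by auto

lemma \<phi>_inj: "inj_on \<phi> (carrier H)"
  using bij by (simp add: bij_betw_def)

lemma \<phi>_eq_iff: "x \<in> carrier H \<Longrightarrow> y \<in> carrier H \<Longrightarrow> \<phi> x = \<phi> y \<longleftrightarrow> x = y"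
  using \<phi>_inj by (auto dest: inj_onD)

lemma \<phi>_eq_one_iff: "x \<in> carrier H \<Longrightarrow> \<phi> x = \<one>\<^bsub>G\<^esub> \<longleftrightarrow> x = \<one>\<^bsub>H\<^esub>"
  using \<phi>_eq_iff[of x "\<one>\<^bsub>H\<^esub>"] by (simp add: \<phi>_one)

lemma finite_H: "finite (carrier H)"
  using bij finite_G subset bij_betw_finite finite_subset by blast

lemma order_eq: "(order G div order H) * order H = order G"
  using card_dvd bij_betw_same_card[OF bij] by (simp add: Coset.order_def)

text \<open>
  The determinant identity, specialized in \<open>\<complex>[t]\<close>. The function \<open>d\<close> must vanish off \<open>S\<close> because the
  variables outside \<open>S\<close> are set to zero in the generalized determinant.
\<close>

lemma group_pencil_eq:
  assumes supp: "\<And>g. g \<in> carrier G \<Longrightarrow> g \<notin> S \<Longrightarrow> d g = 0"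
  shows "group_pencil G d = group_pencil H (\<lambda>h. d (\<phi> h)) ^ (order G div order H)"
proof -
  let ?e = "\<lambda>g. if g = \<one>\<^bsub>G\<^esub> then 1 else monom (d g) 1"
  let ?e' = "\<lambda>h. if h = \<one>\<^bsub>H\<^esub> then 1 else monom (d (\<phi> h)) 1"
  have "poly_eval (\<lambda>h. ?e (\<phi> h)) (group_det H) = poly_eval ?e' (group_det H)"
    unfolding group_det_def gen_group_det_def poly_eval_det_on
    by (rule det_on_cong) (auto simp: poly_eval_Var \<phi>_eq_one_iff)
  also have "\<dots> = group_pencil H (\<lambda>h. d (\<phi> h))"
    unfolding group_det_def by (rule H.poly_eval_gen_group_det) auto
  finally have "poly_eval ?e (poly_hat \<phi> (group_det H ^ (order G div order H))) =
      group_pencil H (\<lambda>h. d (\<phi> h)) ^ (order G div order H)"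
    by (simp add: poly_eval_poly_hat poly_eval_power)
  moreover have "poly_eval ?e (gen_group_det G S) = group_pencil G d"
    using one_mem supp by (rule G.poly_eval_gen_group_det)
  ultimately show ?thesis by (simp add: det_eq)
qed

text \<open>
  The coefficients of \<open>t\<^sup>2\<close> and \<open>t\<^sup>3\<close> carry the factor \<open>order G\<close> on one side, and on the other the factor
  \<open>order H\<close> together with the exponent \<open>order G / order H\<close>. These factors cancel.
\<close>

lemma corr_eq:
  assumes supp: "\<And>g. g \<in> carrier G \<Longrightarrow> g \<notin> S \<Longrightarrow> d g = 0" and one: "d \<one>\<^bsub>G\<^esub> = 0"
  shows "pair_corr G d d = pair_corr H (\<lambda>h. d (\<phi> h)) (\<lambda>h. d (\<phi> h))"
    and "triple_corr G d d d = triple_corr H (\<lambda>h. d (\<phi> h)) (\<lambda>h. d (\<phi> h)) (\<lambda>h. d (\<phi> h))"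
proof -
  let ?r = "order G div order H" and ?d = "\<lambda>h. d (\<phi> h)"
  have one': "?d \<one>\<^bsub>H\<^esub> = 0" using one by (simp add: \<phi>_one)
  note cG = G.low_coeffs_group_pencil[of d, OF finite_G one]
  note cH = H.low_coeffs_group_pencil[of ?d, OF finite_H one']
  note pw = low_coeffs_power[OF cH(1,2), of ?r]
  have eq: "group_pencil G d = group_pencil H ?d ^ ?r" by (rule group_pencil_eq[OF supp])
  have n: "of_nat (order G) = (of_nat ?r * of_nat (order H) :: complex)"
    by (metis order_eq of_nat_mult)
  have "order G > 0" by (rule G.order_gt_0_iff_finite[THEN iffD2, OF finite_G])
  then have n0: "of_nat (order G) \<noteq> (0::complex)" by simp
  have "of_nat (order G) * pair_corr G d d = - (2 * coeff (group_pencil G d) 2)"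
    using cG(3) by simp
  also have "\<dots> = of_nat ?r * - (2 * coeff (group_pencil H ?d) 2)"
    using pw(1) by (simp add: eq)
  also have "\<dots> = of_nat (order G) * pair_corr H ?d ?d"
    unfolding cH(3) n by simp
  finally show "pair_corr G d d = pair_corr H ?d ?d" using n0 by simp
  have "of_nat (order G) * triple_corr G d d d = 3 * coeff (group_pencil G d) 3"
    using cG(4) by simp
  also have "\<dots> = of_nat ?r * (3 * coeff (group_pencil H ?d) 3)"
    using pw(2) by (simp add: eq)
  also have "\<dots> = of_nat (order G) * triple_corr H ?d ?d ?d"
    unfolding cH(4) n by simp
  finally show "triple_corr G d d d = triple_corr H ?d ?d ?d" using n0 by simp
qed

lemma pair_corr_image:
  assumes "\<And>g. g \<in> carrier G \<Longrightarrow> g \<notin> S \<Longrightarrow> d g = 0" and "d \<one>\<^bsub>G\<^esub> = 0"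
    and e: "\<And>h. h \<in> carrier H \<Longrightarrow> d (\<phi> h) = e h"
  shows "pair_corr G d d = pair_corr H e e"
  using corr_eq(1)[of d] pair_corr_cong[OF H.group_axioms e e] assms by simp

lemma triple_corr_image:
  assumes "\<And>g. g \<in> carrier G \<Longrightarrow> g \<notin> S \<Longrightarrow> d g = 0" and "d \<one>\<^bsub>G\<^esub> = 0"
    and e: "\<And>h. h \<in> carrier H \<Longrightarrow> d (\<phi> h) = e h"
  shows "triple_corr G d d d = triple_corr H e e e"
  using corr_eq(2)[of d] triple_corr_cong[OF H.group_axioms e e e] assms by simp

lemma point_mass_image:
  "s \<in> carrier H \<Longrightarrow> h \<in> carrier H \<Longrightarrow> point_mass (\<phi> s) (\<phi> h) = point_mass s h"
  by (simp add: point_mass_def \<phi>_eq_iff)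

lemma point_mass_off_image: "s \<in> carrier H \<Longrightarrow> g \<notin> S \<Longrightarrow> point_mass (\<phi> s) g = 0"
  using \<phi>_mem by (auto simp: point_mass_def)

lemma point_mass_one: "s \<in> carrier H \<Longrightarrow> s \<noteq> \<one>\<^bsub>H\<^esub> \<Longrightarrow> point_mass (\<phi> s) \<one>\<^bsub>G\<^esub> = 0"
  using \<phi>_eq_one_iff[of s] by (auto simp: point_mass_def dest: sym)

text \<open>
  Polarized at point masses, the coefficient of \<open>t\<^sup>2\<close> counts for how many of the two orders of \<open>x\<close>
  and \<open>y\<close> the product is \<open>1\<close>; in a group this happens for both orders or for neither. The unit is
  treated apart since its variable is specialized to \<open>1\<close>.
\<close>

lemma mult_eq_one_iff:
  assumes x: "x \<in> carrier H" and y: "y \<in> carrier H"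
  shows "\<phi> x \<otimes>\<^bsub>G\<^esub> \<phi> y = \<one>\<^bsub>G\<^esub> \<longleftrightarrow> x \<otimes>\<^bsub>H\<^esub> y = \<one>\<^bsub>H\<^esub>"
proof (cases "x = \<one>\<^bsub>H\<^esub> \<or> y = \<one>\<^bsub>H\<^esub>")
  case True
  then show ?thesis using x y by (auto simp: \<phi>_one \<phi>_closed \<phi>_eq_one_iff)
next
  case False
  note rules = point_mass_image point_mass_off_image point_mass_one x y False
  have "pair_corr G (point_mass (\<phi> x)) (point_mass (\<phi> y)) + pair_corr G (point_mass (\<phi> y)) (point_mass (\<phi> x)) =
      pair_corr H (point_mass x) (point_mass y) + pair_corr H (point_mass y) (point_mass x)"
    unfolding pair_corr_polarization[symmetric]
    by (intro arg_cong2[where f = "(-)"] pair_corr_image) (use rules in auto)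
  then have "of_bool (\<phi> x \<otimes>\<^bsub>G\<^esub> \<phi> y = \<one>\<^bsub>G\<^esub>) + of_bool (\<phi> y \<otimes>\<^bsub>G\<^esub> \<phi> x = \<one>\<^bsub>G\<^esub>) =
      (of_bool (x \<otimes>\<^bsub>H\<^esub> y = \<one>\<^bsub>H\<^esub>) + of_bool (y \<otimes>\<^bsub>H\<^esub> x = \<one>\<^bsub>H\<^esub>) :: complex)"
    by (simp only: G.pair_corr_indicator H.pair_corr_indicator finite_G finite_H \<phi>_closed x y)
  then show ?thesis
    using x y \<phi>_closed G.inv_comm H.inv_comm
    by (cases "\<phi> x \<otimes>\<^bsub>G\<^esub> \<phi> y = \<one>\<^bsub>G\<^esub>"; cases "x \<otimes>\<^bsub>H\<^esub> y = \<one>\<^bsub>H\<^esub>") (auto simp: of_bool_def split: if_splits)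
qed

lemma inv_image:
  assumes "x \<in> carrier H"
  shows "\<phi> (inv\<^bsub>H\<^esub> x) = inv\<^bsub>G\<^esub> (\<phi> x)"
  using mult_eq_one_iff[of "inv\<^bsub>H\<^esub> x" x] assms
  by (metis G.inv_equality H.inv_closed H.l_inv \<phi>_closed)

text \<open>
  The coefficient of \<open>t\<^sup>3\<close> counts the orders of \<open>x\<close>, \<open>y\<close>, \<open>z\<close> with product \<open>1\<close>. A cyclic rotation of the
  factors does not change whether the product is \<open>1\<close>, so the six orders fall into two classes of three.
\<close>

lemma triple_products_eq:
  assumes x: "x \<in> carrier H" and y: "y \<in> carrier H" and z: "z \<in> carrier H"
    and ne: "x \<noteq> \<one>\<^bsub>H\<^esub>" "y \<noteq> \<one>\<^bsub>H\<^esub>" "z \<noteq> \<one>\<^bsub>H\<^esub>"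
  shows "of_bool (\<phi> x \<otimes>\<^bsub>G\<^esub> \<phi> y \<otimes>\<^bsub>G\<^esub> \<phi> z = \<one>\<^bsub>G\<^esub>) + of_bool (\<phi> y \<otimes>\<^bsub>G\<^esub> \<phi> x \<otimes>\<^bsub>G\<^esub> \<phi> z = \<one>\<^bsub>G\<^esub>) =
    (of_bool (x \<otimes>\<^bsub>H\<^esub> y \<otimes>\<^bsub>H\<^esub> z = \<one>\<^bsub>H\<^esub>) + of_bool (y \<otimes>\<^bsub>H\<^esub> x \<otimes>\<^bsub>H\<^esub> z = \<one>\<^bsub>H\<^esub>) :: nat)"
proof -
  note rules = point_mass_image point_mass_off_image point_mass_one x y z ne
  let ?x = "\<phi> x" and ?y = "\<phi> y" and ?z = "\<phi> z"
  have "triple_corr G (point_mass ?x) (point_mass ?y) (point_mass ?z) + triple_corr G (point_mass ?x) (point_mass ?z) (point_mass ?y) +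
      triple_corr G (point_mass ?y) (point_mass ?x) (point_mass ?z) + triple_corr G (point_mass ?y) (point_mass ?z) (point_mass ?x) +
      triple_corr G (point_mass ?z) (point_mass ?x) (point_mass ?y) + triple_corr G (point_mass ?z) (point_mass ?y) (point_mass ?x) =
      triple_corr H (point_mass x) (point_mass y) (point_mass z) + triple_corr H (point_mass x) (point_mass z) (point_mass y) +
      triple_corr H (point_mass y) (point_mass x) (point_mass z) + triple_corr H (point_mass y) (point_mass z) (point_mass x) +
      triple_corr H (point_mass z) (point_mass x) (point_mass y) + triple_corr H (point_mass z) (point_mass y) (point_mass x)"
    unfolding triple_corr_polarization[symmetric]
    by (intro arg_cong2[where f = "(-)"] arg_cong2[where f = "(+)"] triple_corr_image) (use rules in auto)
  then have sums: "of_bool (?x \<otimes>\<^bsub>G\<^esub> ?y \<otimes>\<^bsub>G\<^esub> ?z = \<one>\<^bsub>G\<^esub>) + of_bool (?x \<otimes>\<^bsub>G\<^esub> ?z \<otimes>\<^bsub>G\<^esub> ?y = \<one>\<^bsub>G\<^esub>) +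
      of_bool (?y \<otimes>\<^bsub>G\<^esub> ?x \<otimes>\<^bsub>G\<^esub> ?z = \<one>\<^bsub>G\<^esub>) + of_bool (?y \<otimes>\<^bsub>G\<^esub> ?z \<otimes>\<^bsub>G\<^esub> ?x = \<one>\<^bsub>G\<^esub>) +
      of_bool (?z \<otimes>\<^bsub>G\<^esub> ?x \<otimes>\<^bsub>G\<^esub> ?y = \<one>\<^bsub>G\<^esub>) + of_bool (?z \<otimes>\<^bsub>G\<^esub> ?y \<otimes>\<^bsub>G\<^esub> ?x = \<one>\<^bsub>G\<^esub>) =
      (of_bool (x \<otimes>\<^bsub>H\<^esub> y \<otimes>\<^bsub>H\<^esub> z = \<one>\<^bsub>H\<^esub>) + of_bool (x \<otimes>\<^bsub>H\<^esub> z \<otimes>\<^bsub>H\<^esub> y = \<one>\<^bsub>H\<^esub>) +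
      of_bool (y \<otimes>\<^bsub>H\<^esub> x \<otimes>\<^bsub>H\<^esub> z = \<one>\<^bsub>H\<^esub>) + of_bool (y \<otimes>\<^bsub>H\<^esub> z \<otimes>\<^bsub>H\<^esub> x = \<one>\<^bsub>H\<^esub>) +
      of_bool (z \<otimes>\<^bsub>H\<^esub> x \<otimes>\<^bsub>H\<^esub> y = \<one>\<^bsub>H\<^esub>) + of_bool (z \<otimes>\<^bsub>H\<^esub> y \<otimes>\<^bsub>H\<^esub> x = \<one>\<^bsub>H\<^esub>) :: complex)"
    by (simp only: G.triple_corr_indicator H.triple_corr_indicator finite_G finite_H \<phi>_closed x y z)
  have cycG: "a \<otimes>\<^bsub>G\<^esub> b \<otimes>\<^bsub>G\<^esub> c = \<one>\<^bsub>G\<^esub> \<longleftrightarrow> c \<otimes>\<^bsub>G\<^esub> a \<otimes>\<^bsub>G\<^esub> b = \<one>\<^bsub>G\<^esub>"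
    if "a \<in> carrier G" "b \<in> carrier G" "c \<in> carrier G" for a b c
    using that by (metis G.inv_comm G.m_assoc G.m_closed)
  have cycH: "a \<otimes>\<^bsub>H\<^esub> b \<otimes>\<^bsub>H\<^esub> c = \<one>\<^bsub>H\<^esub> \<longleftrightarrow> c \<otimes>\<^bsub>H\<^esub> a \<otimes>\<^bsub>H\<^esub> b = \<one>\<^bsub>H\<^esub>"
    if "a \<in> carrier H" "b \<in> carrier H" "c \<in> carrier H" for a b c
    using that by (metis H.inv_comm H.m_assoc H.m_closed)
  have "(?x \<otimes>\<^bsub>G\<^esub> ?z \<otimes>\<^bsub>G\<^esub> ?y = \<one>\<^bsub>G\<^esub>) = (?y \<otimes>\<^bsub>G\<^esub> ?x \<otimes>\<^bsub>G\<^esub> ?z = \<one>\<^bsub>G\<^esub>)"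
    "(?z \<otimes>\<^bsub>G\<^esub> ?y \<otimes>\<^bsub>G\<^esub> ?x = \<one>\<^bsub>G\<^esub>) = (?y \<otimes>\<^bsub>G\<^esub> ?x \<otimes>\<^bsub>G\<^esub> ?z = \<one>\<^bsub>G\<^esub>)"
    "(?y \<otimes>\<^bsub>G\<^esub> ?z \<otimes>\<^bsub>G\<^esub> ?x = \<one>\<^bsub>G\<^esub>) = (?x \<otimes>\<^bsub>G\<^esub> ?y \<otimes>\<^bsub>G\<^esub> ?z = \<one>\<^bsub>G\<^esub>)"
    "(?z \<otimes>\<^bsub>G\<^esub> ?x \<otimes>\<^bsub>G\<^esub> ?y = \<one>\<^bsub>G\<^esub>) = (?x \<otimes>\<^bsub>G\<^esub> ?y \<otimes>\<^bsub>G\<^esub> ?z = \<one>\<^bsub>G\<^esub>)"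
    using x y z cycG \<phi>_closed by blast+
  moreover have "(x \<otimes>\<^bsub>H\<^esub> z \<otimes>\<^bsub>H\<^esub> y = \<one>\<^bsub>H\<^esub>) = (y \<otimes>\<^bsub>H\<^esub> x \<otimes>\<^bsub>H\<^esub> z = \<one>\<^bsub>H\<^esub>)"
    "(z \<otimes>\<^bsub>H\<^esub> y \<otimes>\<^bsub>H\<^esub> x = \<one>\<^bsub>H\<^esub>) = (y \<otimes>\<^bsub>H\<^esub> x \<otimes>\<^bsub>H\<^esub> z = \<one>\<^bsub>H\<^esub>)"
    "(y \<otimes>\<^bsub>H\<^esub> z \<otimes>\<^bsub>H\<^esub> x = \<one>\<^bsub>H\<^esub>) = (x \<otimes>\<^bsub>H\<^esub> y \<otimes>\<^bsub>H\<^esub> z = \<one>\<^bsub>H\<^esub>)"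
    "(z \<otimes>\<^bsub>H\<^esub> x \<otimes>\<^bsub>H\<^esub> y = \<one>\<^bsub>H\<^esub>) = (x \<otimes>\<^bsub>H\<^esub> y \<otimes>\<^bsub>H\<^esub> z = \<one>\<^bsub>H\<^esub>)"
    using x y z cycH by blast+
  ultimately show ?thesis using sums by (auto simp: of_bool_def split: if_splits)
qed

text \<open>
  This is the count for the triple \<open>x\<close>, \<open>y\<close>, \<open>w\<^bsup>-1\<^esup>\<close>. When one of the three is the unit, whose variable
  is specialized to \<open>1\<close>, the claim concerns only products of two elements.
\<close>

lemma products_eq:
  assumes x: "x \<in> carrier H" and y: "y \<in> carrier H" and w: "w \<in> carrier H"
  shows "of_bool (\<phi> x \<otimes>\<^bsub>G\<^esub> \<phi> y = \<phi> w) + of_bool (\<phi> y \<otimes>\<^bsub>G\<^esub> \<phi> x = \<phi> w) =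
    (of_bool (x \<otimes>\<^bsub>H\<^esub> y = w) + of_bool (y \<otimes>\<^bsub>H\<^esub> x = w) :: nat)"
proof (cases "x = \<one>\<^bsub>H\<^esub> \<or> y = \<one>\<^bsub>H\<^esub> \<or> w = \<one>\<^bsub>H\<^esub>")
  case True
  then show ?thesis using x y w
    by (auto simp: \<phi>_one \<phi>_closed \<phi>_eq_iff mult_eq_one_iff)
next
  case False
  have iG: "a \<otimes>\<^bsub>G\<^esub> inv\<^bsub>G\<^esub> b = \<one>\<^bsub>G\<^esub> \<longleftrightarrow> a = b" if "a \<in> carrier G" "b \<in> carrier G" for a b
    using that by (rule G.mult_inv_eq_one_iff)
  have iH: "a \<otimes>\<^bsub>H\<^esub> inv\<^bsub>H\<^esub> b = \<one>\<^bsub>H\<^esub> \<longleftrightarrow> a = b" if "a \<in> carrier H" "b \<in> carrier H" for a b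
    using that by (rule H.mult_inv_eq_one_iff)
  have "inv\<^bsub>H\<^esub> w \<noteq> \<one>\<^bsub>H\<^esub>" using w False by (metis H.inv_inv H.inv_one)
  then show ?thesis
    using triple_products_eq[of x y "inv\<^bsub>H\<^esub> w"] False x y w
    by (simp add: inv_image iG iH \<phi>_closed)
qed

sublocale half_homomorphism H G \<phi>
proof
  fix x y assume x: "x \<in> carrier H" and y: "y \<in> carrier H"
  have "of_bool (\<phi> x \<otimes>\<^bsub>G\<^esub> \<phi> y = \<phi> (x \<otimes>\<^bsub>H\<^esub> y)) + of_bool (\<phi> y \<otimes>\<^bsub>G\<^esub> \<phi> x = \<phi> (x \<otimes>\<^bsub>H\<^esub> y)) \<noteq> (0 :: nat)"
    using products_eq[of x y "x \<otimes>\<^bsub>H\<^esub> y"] x y by simp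
  then show "\<phi> (x \<otimes>\<^bsub>H\<^esub> y) = \<phi> x \<otimes>\<^bsub>G\<^esub> \<phi> y \<or> \<phi> (x \<otimes>\<^bsub>H\<^esub> y) = \<phi> y \<otimes>\<^bsub>G\<^esub> \<phi> x"
    by (auto split: if_splits)
qed (auto simp: \<phi>_closed \<phi>_inj)

text \<open>
  Whether \<open>\<phi>\<close> preserves or reverses products, a product of two elements of \<open>S\<close> is the image of a product
  in \<open>H\<close>.
\<close>

lemma subgroup_image: "subgroup S G"
proof (rule G.subgroupI[OF subset])
  show "S \<noteq> {}" using one_mem by auto
  have S: "S = \<phi> ` carrier H" using bij by (simp add: bij_betw_def)
  show "inv\<^bsub>G\<^esub> a \<in> S" if "a \<in> S" for a
    using that unfolding S by (metis (no_types, lifting) H.inv_closed imageE image_eqI inv_image)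
  show "a \<otimes>\<^bsub>G\<^esub> b \<in> S" if ab: "a \<in> S" "b \<in> S" for a b
  proof -
    obtain x y where x: "x \<in> carrier H" "a = \<phi> x" and y: "y \<in> carrier H" "b = \<phi> y"
      using ab unfolding S by auto
    have "a \<otimes>\<^bsub>G\<^esub> b = \<phi> (x \<otimes>\<^bsub>H\<^esub> y) \<or> a \<otimes>\<^bsub>G\<^esub> b = \<phi> (y \<otimes>\<^bsub>H\<^esub> x)"
      using hom_or_antihom x y by auto
    then show ?thesis using x y \<phi>_mem by auto
  qed
qed

end

theorem theorem1p2:
  fixes G :: "('a, 'm) monoid_scheme"
    and H :: "('b, 'n) monoid_scheme"
    and S :: "'a set"
    and \<phi> :: "'b \<Rightarrow> 'a"
  assumes "group G"
    and "finite (carrier G)"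
    and "S \<subseteq> carrier G"
    and "\<one>\<^bsub>G\<^esub> \<in> S"
    and "card S dvd order G"
    and "group H"
    and "bij_betw \<phi> (carrier H) S"
    and "\<phi> \<one>\<^bsub>H\<^esub> = \<one>\<^bsub>G\<^esub>"
    and "gen_group_det G S = poly_hat \<phi> (group_det H ^ (order G div order H))"
  shows "group (G\<lparr>carrier := S\<rparr>)
    \<and> G\<lparr>carrier := S\<rparr> \<cong> H
    \<and> (\<phi> \<in> iso H (G\<lparr>carrier := S\<rparr>) \<or> \<phi> \<in> anti_iso H (G\<lparr>carrier := S\<rparr>))"
proof -
  interpret determinant_factorization G H S \<phi>
    using assms by (simp add: determinant_factorization_def determinant_factorization_axioms_def)
  let ?K = "G\<lparr>carrier := S\<rparr>"
  have K: "group ?K" by (rule G.subgroup_imp_group[OF subgroup_image])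
  have alt: "\<phi> \<in> iso H ?K \<or> \<phi> \<in> anti_iso H ?K"
    using hom_or_antihom bij \<phi>_mem by (auto simp: iso_def hom_def anti_iso_def)
  have "\<exists>\<psi>. \<psi> \<in> iso H ?K"
    using alt
  proof
    assume anti: "\<phi> \<in> anti_iso H ?K"
    \<comment> \<open>An anti-isomorphism becomes an isomorphism after composition with inversion.\<close>
    have "bij_betw (\<lambda>x. inv\<^bsub>H\<^esub> x) (carrier H) (carrier H)"
      by (rule bij_betwI[where g = "\<lambda>x. inv\<^bsub>H\<^esub> x"]) auto
    then have "bij_betw (\<phi> \<circ> (\<lambda>x. inv\<^bsub>H\<^esub> x)) (carrier H) S"
      using bij by (rule bij_betw_trans)
    then have "\<phi> \<circ> (\<lambda>x. inv\<^bsub>H\<^esub> x) \<in> iso H ?K"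
      using anti by (auto simp: iso_def hom_def anti_iso_def H.inv_mult_group \<phi>_mem)
    then show ?thesis by blast
  qed blast
  then have "H \<cong> ?K" by (auto simp: is_iso_def)
  then have "?K \<cong> H" by (rule H.iso_sym)
  with K alt show ?thesis by simp
qed

end
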